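(* Let $n\ge 1$ and $0\le k\le n-1$ be integers and define $f_k\colon\{0,1\}^n\to\{0,1,\perp\}$ by $f_k(x)=0$ if $|x|\le k$, $f_k(x)=\perp$ if $k+1\le |x|\le n-1$, and $f_k(x)=1$ if $|x|=n$. Then $\mathrm{NADT^{\oplus}}(f_k)=\mathrm{DT^{\oplus}}(f_k)=k+1$.
   Context: $|x|$ denotes the Hamming weight of $x$. For a partial function $f$, $\operatorname{Dom}(f)=f^{-1}(\{0,1\})$. For $s,x\in\{0,1\}^n$ let $\langle s,x\rangle=\bigoplus_i s_i\wedge x_i$. A (adaptive) parity decision tree computing $f$ is a decision tree in which each internal node queries $\langle s,x\rangle$ for some $s\in\{0,1\}^n$ and branches on the answer, and whose leaves are labelled by outputs, such that on every $x\in\operatorname{Dom}(f)$ the reached leaf outputs $f(x)$; $\mathrm{DT^{\oplus}}(f)$ is the minimum depth (worst-case number of queries) of such a tree. A non-adaptive parity decision tree of cost $p$ for $f$ consists of vectors $s_1,\dots,s_p\in\{0,1\}^n$ and a total function $l\colon\{0,1\}^p\to\{0,1\}$ with $l(\langle s_1,x\rangle,\dots,\langle s_p,x\rangle)=f(x)$ for all $x\in\operatorname{Dom}(f)$; $\mathrm{NADT^{\oplus}}(f)$ is the minimum such $p$. *)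

theory Defs
  imports Main
begin

text \<open>
  The cube \<open>{0,1}\<^sup>n\<close> is the set of boolean lists of length \<open>n\<close>, and a partial function
  \<open>{0,1}\<^sup>n \<rightarrow> {0,1,\<bottom>}\<close> is a map \<open>bool list \<Rightarrow> bool option\<close> with \<^const>\<open>None\<close> for \<open>\<bottom>\<close>; its values on
  lists of any other length are irrelevant.
\<close>

definition cube :: "nat \<Rightarrow> bool list set" where
  "cube n = {x. length x = n}"

definition hweight :: "bool list \<Rightarrow> nat" where
  "hweight x = count_list x True"

text \<open>On \<^typ>\<open>bool\<close>, inequality is exclusive or.\<close>

definition parity :: "bool list \<Rightarrow> bool list \<Rightarrow> bool" where
  "parity s x = foldr (\<noteq>) (map2 (\<and>) s x) False"

definition Dom :: "nat \<Rightarrow> (bool list \<Rightarrow> bool option) \<Rightarrow> bool list set" where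
  "Dom n f = {x \<in> cube n. f x \<in> {Some False, Some True}}"

text \<open>In \<open>Query s t0 t1\<close>, \<open>t0\<close> is the subtree for answer \<open>0\<close> and \<open>t1\<close> the one for answer \<open>1\<close>.\<close>

datatype ptree = Leaf bool | Query "bool list" ptree ptree

fun wf_ptree :: "nat \<Rightarrow> ptree \<Rightarrow> bool" where
  "wf_ptree n (Leaf b) \<longleftrightarrow> True"
| "wf_ptree n (Query s t0 t1) \<longleftrightarrow> s \<in> cube n \<and> wf_ptree n t0 \<and> wf_ptree n t1"

fun ptree_output :: "ptree \<Rightarrow> bool list \<Rightarrow> bool" where
  "ptree_output (Leaf b) x = b"
| "ptree_output (Query s t0 t1) x = (if parity s x then ptree_output t1 x else ptree_output t0 x)"

fun ptree_depth :: "ptree \<Rightarrow> nat" where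
  "ptree_depth (Leaf b) = 0"
| "ptree_depth (Query s t0 t1) = Suc (max (ptree_depth t0) (ptree_depth t1))"

definition ptree_computes :: "nat \<Rightarrow> ptree \<Rightarrow> (bool list \<Rightarrow> bool option) \<Rightarrow> bool" where
  "ptree_computes n t f \<longleftrightarrow> wf_ptree n t \<and> (\<forall>x \<in> Dom n f. f x = Some (ptree_output t x))"

text \<open>
  The minima below are over nonempty sets: querying all unit vectors determines the input.
\<close>

definition DT_parity :: "nat \<Rightarrow> (bool list \<Rightarrow> bool option) \<Rightarrow> nat" where
  "DT_parity n f = (LEAST d. \<exists>t. ptree_computes n t f \<and> ptree_depth t = d)"

definition nonadaptive_computes ::
    "nat \<Rightarrow> bool list list \<Rightarrow> (bool list \<Rightarrow> bool) \<Rightarrow> (bool list \<Rightarrow> bool option) \<Rightarrow> bool" where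
  "nonadaptive_computes n ss l f \<longleftrightarrow>
     set ss \<subseteq> cube n \<and> (\<forall>x \<in> Dom n f. f x = Some (l (map (\<lambda>s. parity s x) ss)))"

definition NADT_parity :: "nat \<Rightarrow> (bool list \<Rightarrow> bool option) \<Rightarrow> nat" where
  "NADT_parity n f = (LEAST p. \<exists>ss l. nonadaptive_computes n ss l f \<and> length ss = p)"

definition fk :: "nat \<Rightarrow> nat \<Rightarrow> bool list \<Rightarrow> bool option" where
  "fk n k x =
     (if hweight x \<le> k then Some False
      else if hweight x \<le> n - 1 then None
      else Some True)"

end

theory Submission
  imports Defs
begin

text \<open>
  Querying the first \<open>k + 1\<close> coordinates separates weight \<open>n\<close> from weight at most \<open>k\<close>. Conversely, a
  tree makes at most \<open>m\<close> queries along the path of the all-ones input. Among the inputs giving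
  the same answers to these queries take one of least weight. If its support had more than \<open>m\<close>
  elements, two subsets of the support would receive equal answers by the pigeonhole principle,
  and removing their symmetric difference would lower the weight without changing any answer.
  So the tree cannot tell the all-ones input from one of weight at most \<open>m\<close>, whence \<open>m > k\<close>.
\<close>

text \<open>Elements of \<open>X \<inter> Y\<close> enter both counts on the right and cancel modulo
  2, so parity against a fixed \<open>U\<close> is additive under symmetric difference.\<close>

lemma odd_card_Int_sym_diff:
  assumes "finite X" "finite Y"
  shows "odd (card (U \<inter> ((X - Y) \<union> (Y - X)))) \<longleftrightarrow> odd (card (U \<inter> X)) \<noteq> odd (card (U \<inter> Y))"
proof -
  have split: "card (U \<inter> A) = card (U \<inter> (A - B)) + card (U \<inter> (A \<inter> B))" if "finite A" for A B
  proof -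
    have "U \<inter> A = U \<inter> (A - B) \<union> U \<inter> (A \<inter> B)"
      by blast
    also have "card \<dots> = card (U \<inter> (A - B)) + card (U \<inter> (A \<inter> B))"
      using that by (intro card_Un_disjoint) auto
    finally show ?thesis .
  qed
  have "card (U \<inter> ((X - Y) \<union> (Y - X))) = card (U \<inter> (X - Y)) + card (U \<inter> (Y - X))"
    unfolding Int_Un_distrib using assms by (intro card_Un_disjoint) auto
  with split[OF assms(1), of Y] split[OF assms(2), of X] show ?thesis
    by (auto simp: Int_commute[of Y X])
qed

text \<open>Strong induction on \<open>card S\<close> stands in for the choice of least weight:
  while the set has more elements than there are tests, a nonempty part can be removed without
  changing any parity.\<close>

lemma small_subset_same_parities:
  assumes "finite S"
  shows "\<exists>T \<subseteq> S. card T \<le> length Us \<and> (\<forall>U \<in> set Us. odd (card (U \<inter> T)) = odd (card (U \<inter> S)))"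
  using assms
proof (induction "card S" arbitrary: S rule: less_induct)
  case less
  show ?case
  proof (cases "card S \<le> length Us")
    case True
    then show ?thesis by blast
  next
    case False
    define ans where "ans X = map (\<lambda>U. odd (card (U \<inter> X))) Us" for X
    \<comment> \<open>\<open>set bs \<subseteq> UNIV\<close> puts the set of answer vectors into the
      form that \<open>finite_lists_length_eq\<close> and \<open>card_lists_length_eq\<close> speak
      of.\<close>
    let ?L = "{bs :: bool list. set bs \<subseteq> UNIV \<and> length bs = length Us}"
    have "card (ans ` Pow S) \<le> card ?L"
      by (intro card_mono finite_lists_length_eq) (auto simp: ans_def)
    also have "card ?L = 2 ^ length Us"
      by (subst card_lists_length_eq) (auto simp: card_UNIV_bool)
    also have "\<dots> < 2 ^ card S"
      using False by simp
    also have "\<dots> = card (Pow S)"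
      using less.prems by (simp add: card_Pow)
    finally have "\<not> inj_on ans (Pow S)"
      by (rule pigeonhole)
    then obtain X Y where XY: "X \<subseteq> S" "Y \<subseteq> S" "X \<noteq> Y" "ans X = ans Y"
      by (auto simp: inj_on_def)
    define D where "D = (X - Y) \<union> (Y - X)"
    have D: "D \<subseteq> S" "D \<noteq> {}" and fin: "finite X" "finite Y" "finite D"
      using XY less.prems by (auto simp: D_def intro: finite_subset)
    have same: "odd (card (U \<inter> (S - D))) = odd (card (U \<inter> S))" if "U \<in> set Us" for U
    proof -
      have "odd (card (U \<inter> X)) = odd (card (U \<inter> Y))"
        using XY(4) that by (auto simp: ans_def)
      then have "even (card (U \<inter> D))"
        unfolding D_def using odd_card_Int_sym_diff[OF fin(1,2), of U] by simp
      \<comment> \<open>As \<open>D \<subseteq> S\<close>, removing \<open>D\<close> amounts to a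
        symmetric difference, so each parity changes by that of \<open>U \<inter> D\<close>, which
        is even.\<close>
      moreover have "S - D = (S - D) \<union> (D - S)"
        using D(1) by blast
      ultimately show ?thesis
        using odd_card_Int_sym_diff[OF less.prems fin(3), of U] by simp
    qed
    have "card (S - D) < card S"
      using D less.prems by (intro psubset_card_mono) auto
    from less.hyps[OF this] less.prems obtain T where "T \<subseteq> S - D" "card T \<le> length Us"
      "\<forall>U \<in> set Us. odd (card (U \<inter> T)) = odd (card (U \<inter> (S - D)))"
      by auto
    with same show ?thesis by blast
  qed
qed

text \<open>Passing from bit lists to their supports turns the inner product modulo 2 into the
  parity of an intersection, the setting of the lemmas above.\<close>

lemma parity_eq_odd_card:
  assumes "length s = length x"
  shows "parity s x \<longleftrightarrow> odd (card ({i. i < length s \<and> s ! i} \<inter> {i. i < length x \<and> x ! i}))"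
  using assms
proof (induction s x rule: list_induct2)
  case Nil
  then show ?case by (simp add: parity_def)
next
  case (Cons a s b x)
  let ?A = "{i. i < length s \<and> s ! i} \<inter> {i. i < length x \<and> x ! i}"
  \<comment> \<open>The heads account for index 0; the common indices of the tails move up by
    one.\<close>
  have "{i. i < length (a # s) \<and> (a # s) ! i} \<inter> {i. i < length (b # x) \<and> (b # x) ! i}
      = (if a \<and> b then {0} else {}) \<union> Suc ` ?A"
  proof (rule set_eqI)
    fix i
    show "i \<in> {i. i < length (a # s) \<and> (a # s) ! i} \<inter> {i. i < length (b # x) \<and> (b # x) ! i}
      \<longleftrightarrow> i \<in> (if a \<and> b then {0} else {}) \<union> Suc ` ?A"
      by (cases i) auto
  qed
  moreover have "card ((if a \<and> b then {0} else {}) \<union> Suc ` ?A) = (if a \<and> b then 1 else 0) + card ?A"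
    by (subst card_Un_disjoint) (auto simp: card_image)
  moreover have "parity (a # s) (b # x) \<longleftrightarrow> (a \<and> b) \<noteq> parity s x"
    by (simp add: parity_def)
  ultimately show ?case
    using Cons.IH by auto
qed

lemma hweight_eq_card: "hweight x = card {i. i < length x \<and> x ! i}"
  unfolding hweight_def count_list_eq_length_filter length_filter_conv_card by simp

lemma exists_light_input_same_parities:
  assumes "x \<in> cube n" "set ss \<subseteq> cube n"
  shows "\<exists>y \<in> cube n. hweight y \<le> length ss \<and> (\<forall>s \<in> set ss. parity s y = parity s x)"
proof -
  define supp :: "bool list \<Rightarrow> nat set" where "supp z = {i. i < length z \<and> z ! i}" for z
  have "finite (supp x)"
    by (simp add: supp_def)
  from small_subset_same_parities[OF this, of "map supp ss"] obtain T where T: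
    "T \<subseteq> supp x" "card T \<le> length ss"
    "\<forall>s \<in> set ss. odd (card (supp s \<inter> T)) = odd (card (supp s \<inter> supp x))"
    by auto
  \<comment> \<open>The characteristic vector of \<open>T\<close>. Since
    \<open>T \<subseteq> supp x\<close>, all elements of \<open>T\<close> are below
    \<open>n\<close>, so its support is exactly \<open>T\<close>.\<close>
  define y where "y = map (\<lambda>i. i \<in> T) [0..<n]"
  have y: "y \<in> cube n" "supp y = T"
    using T(1) assms(1) by (auto simp: y_def cube_def supp_def)
  have "parity s y = parity s x" if "s \<in> set ss" for s
  proof -
    have "length s = length y" "length s = length x"
      using that assms y(1) by (auto simp: cube_def)
    then have "parity s y = odd (card (supp s \<inter> supp y))" "parity s x = odd (card (supp s \<inter> supp x))"
      by (simp_all only: parity_eq_odd_card supp_def)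
    with T(3) that y(2) show ?thesis
      by simp
  qed
  moreover have "hweight y \<le> length ss"
    using T(2) y(2) by (simp add: hweight_eq_card supp_def)
  ultimately show ?thesis
    using y(1) by blast
qed

text \<open>\<open>ss\<close> collects the queries that \<open>x\<close> meets; an input answering
  them alike takes the same branches. Their number is only bounded by the depth because the path of
  \<open>x\<close> may be shorter than the longest one.\<close>

lemma ptree_path_queries:
  assumes "wf_ptree n t"
  shows "\<exists>ss. set ss \<subseteq> cube n \<and> length ss \<le> ptree_depth t \<and>
    (\<forall>y. (\<forall>s \<in> set ss. parity s y = parity s x) \<longrightarrow> ptree_output t y = ptree_output t x)"
  using assms
proof (induction t)
  case (Leaf b)
  then show ?case by (intro exI[of _ "[]"]) simp
next
  case (Query s t0 t1)
  \<comment> \<open>The subtree that \<open>x\<close> enters. An input agreeing with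
    \<open>x\<close> on \<open>s\<close> enters it too, so the list for this subtree only has to be
    extended by \<open>s\<close>.\<close>
  define t where "t = (if parity s x then t1 else t0)"
  have "\<exists>ss. set ss \<subseteq> cube n \<and> length ss \<le> ptree_depth t \<and>
    (\<forall>y. (\<forall>s \<in> set ss. parity s y = parity s x) \<longrightarrow> ptree_output t y = ptree_output t x)"
    using Query by (simp add: t_def)
  then obtain ss where ss: "set ss \<subseteq> cube n" "length ss \<le> ptree_depth t"
    "\<forall>y. (\<forall>s \<in> set ss. parity s y = parity s x) \<longrightarrow> ptree_output t y = ptree_output t x"
    by blast
  show ?case
  proof (intro exI[of _ "s # ss"] conjI allI impI)
    show "set (s # ss) \<subseteq> cube n"
      using ss(1) Query.prems by simp
    show "length (s # ss) \<le> ptree_depth (Query s t0 t1)"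
      using ss(2) by (simp add: t_def split: if_splits)
    fix y assume y: "\<forall>r \<in> set (s # ss). parity r y = parity r x"
    then have "ptree_output (Query s t0 t1) y = ptree_output t y"
      by (simp add: t_def)
    also have "\<dots> = ptree_output t x"
      by (rule ss(3)[rule_format]) (rule y[rule_format], simp)
    also have "\<dots> = ptree_output (Query s t0 t1) x"
      by (simp add: t_def)
    finally show "ptree_output (Query s t0 t1) y = ptree_output (Query s t0 t1) x" .
  qed
qed

text \<open>All nodes of a level ask the same query; the answers so far are remembered by fixing the
  leading entries of the argument of \<open>l\<close>.\<close>

fun ptree_of_queries :: "bool list list \<Rightarrow> (bool list \<Rightarrow> bool) \<Rightarrow> ptree" where
  "ptree_of_queries [] l = Leaf (l [])"
| "ptree_of_queries (s # ss) l =
     Query s (ptree_of_queries ss (\<lambda>bs. l (False # bs))) (ptree_of_queries ss (\<lambda>bs. l (True # bs)))"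

lemma ptree_output_of_queries:
  "ptree_output (ptree_of_queries ss l) x = l (map (\<lambda>s. parity s x) ss)"
  by (induction ss l rule: ptree_of_queries.induct) auto

lemma ptree_depth_of_queries: "ptree_depth (ptree_of_queries ss l) = length ss"
  by (induction ss l rule: ptree_of_queries.induct) auto

lemma wf_ptree_of_queries: "set ss \<subseteq> cube n \<Longrightarrow> wf_ptree n (ptree_of_queries ss l)"
  by (induction ss l rule: ptree_of_queries.induct) auto

text \<open>Thanks to this conversion, the lower bound has to be shown only for trees and the upper
  bound only for non-adaptive queries.\<close>

lemma nonadaptive_imp_ptree_computes:
  "nonadaptive_computes n ss l f \<Longrightarrow> ptree_computes n (ptree_of_queries ss l) f"
  by (auto simp: nonadaptive_computes_def ptree_computes_def ptree_output_of_queries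
      wf_ptree_of_queries)

lemma hweight_replicate_True: "hweight (replicate n True) = n"
  by (induction n) (auto simp: hweight_def)

lemma ptree_computes_fk_depth:
  assumes "k < n" "ptree_computes n t (fk n k)"
  shows "k < ptree_depth t"
proof (rule ccontr)
  assume shallow: "\<not> k < ptree_depth t"
  let ?x = "replicate n True"
  \<comment> \<open>From \<open>k < n\<close> also \<open>n\<close> is positive, so the weight
    \<open>n\<close> exceeds both \<open>k\<close> and the truncated difference
    \<open>n - 1\<close>.\<close>
  have x: "?x \<in> cube n" "fk n k ?x = Some True"
    using assms(1) by (auto simp: cube_def fk_def hweight_replicate_True)
  obtain ss where ss: "set ss \<subseteq> cube n" "length ss \<le> ptree_depth t"
    "\<forall>y. (\<forall>s \<in> set ss. parity s y = parity s ?x) \<longrightarrow> ptree_output t y = ptree_output t ?x"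
    using ptree_path_queries[of n t ?x] assms(2) by (auto simp: ptree_computes_def)
  obtain y where y: "y \<in> cube n" "hweight y \<le> length ss" "ptree_output t y = ptree_output t ?x"
    using exists_light_input_same_parities[OF x(1) ss(1)] ss(3) by blast
  \<comment> \<open>The weight of \<open>y\<close> is at most \<open>length ss\<close>, hence at
    most the depth, hence at most \<open>k\<close>. Thus \<open>y\<close> and the all-ones input
    need different outputs but receive the same.\<close>
  have "fk n k y = Some False"
    using y(2) ss(2) shallow by (simp add: fk_def)
  then show False
    using assms(2) x y(1,3) by (auto simp: ptree_computes_def Dom_def)
qed

lemma nonadaptive_computes_fk:
  assumes "k < n"
  shows "\<exists>ss l. nonadaptive_computes n ss l (fk n k) \<and> length ss = k + 1"
proof -
  \<comment> \<open>Unit vectors: querying \<open>e i\<close> reads bit \<open>i\<close>.\<close>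
  define e where "e i = map (\<lambda>j. j = i) [0..<n]" for i :: nat
  define ss where "ss = map e [0..<k + 1]"
  have parity_e: "parity (e i) x = x ! i" if "x \<in> cube n" "i < n" for x i
  proof -
    have "{j. j < length (e i) \<and> e i ! j} \<inter> {j. j < length x \<and> x ! j} = (if x ! i then {i} else {})"
      using that by (auto simp: e_def cube_def)
    moreover have "length (e i) = length x"
      using that by (simp add: e_def cube_def)
    ultimately show ?thesis
      by (simp add: parity_eq_odd_card)
  qed
  \<comment> \<open>The output is the conjunction of the bits read.\<close>
  have "fk n k x = Some (list_all id (map (\<lambda>s. parity s x) ss))" if "x \<in> Dom n (fk n k)" for x
  proof -
    have x: "x \<in> cube n" and len: "length x = n"
      using that by (auto simp: Dom_def cube_def)
    have all: "list_all id (map (\<lambda>s. parity s x) ss) \<longleftrightarrow> (\<forall>i < k + 1. x ! i)"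
      using assms parity_e[OF x] by (auto simp: ss_def list_all_iff less_Suc_eq)
    show ?thesis
    proof (cases "hweight x \<le> k")
      case True
      have "\<not> (\<forall>i < k + 1. x ! i)"
      proof
        assume "\<forall>i < k + 1. x ! i"
        then have "card {..<k + 1} \<le> card {i. i < length x \<and> x ! i}"
          using assms len by (intro card_mono) auto
        with True show False by (simp add: hweight_eq_card)
      qed
      with all True show ?thesis by (simp add: fk_def)
    next
      case False
      \<comment> \<open>Membership in the domain excludes the undefined range, so the weight exceeds
        \<open>n - 1\<close> and every position holds a 1.\<close>
      then have "card {i. i < n \<and> x ! i} \<ge> n"
        using that len by (auto simp: Dom_def fk_def hweight_eq_card split: if_splits)
      then have full: "{i. i < n \<and> x ! i} = {..<n}"
        by (intro card_seteq) auto
      have "\<forall>i < k + 1. x ! i"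
      proof (intro allI impI)
        fix i assume "i < k + 1"
        then have "i \<in> {i. i < n \<and> x ! i}"
          unfolding full using assms by simp
        then show "x ! i"
          by simp
      qed
      moreover have "fk n k x = Some True"
        using False that by (simp add: Dom_def fk_def split: if_splits)
      ultimately show ?thesis
        using all by simp
    qed
  qed
  then have "nonadaptive_computes n ss (list_all id) (fk n k)"
    by (auto simp: nonadaptive_computes_def ss_def e_def cube_def)
  then show ?thesis
    by (intro exI[of _ ss] exI[of _ "list_all id"]) (simp add: ss_def)
qed

theorem theorem26:
  fixes n k :: nat
  assumes "1 \<le> n" and "k \<le> n - 1"
  shows "NADT_parity n (fk n k) = k + 1 \<and> DT_parity n (fk n k) = k + 1"
proof
  have kn: "k < n"
    using assms by simp
  obtain ss l where ss: "nonadaptive_computes n ss l (fk n k)" "length ss = k + 1"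
    using nonadaptive_computes_fk[OF kn] by blast
  show "NADT_parity n (fk n k) = k + 1"
    unfolding NADT_parity_def
  proof (rule Least_equality)
    fix p assume "\<exists>ss l. nonadaptive_computes n ss l (fk n k) \<and> length ss = p"
    then show "k + 1 \<le> p"
      using ptree_computes_fk_depth[OF kn nonadaptive_imp_ptree_computes]
      by (fastforce simp: ptree_depth_of_queries)
  qed (use ss in blast)
  show "DT_parity n (fk n k) = k + 1"
    unfolding DT_parity_def
  proof (rule Least_equality)
    show "\<exists>t. ptree_computes n t (fk n k) \<and> ptree_depth t = k + 1"
      using nonadaptive_imp_ptree_computes[OF ss(1)] ss(2) ptree_depth_of_queries by metis
    fix d assume "\<exists>t. ptree_computes n t (fk n k) \<and> ptree_depth t = d"
    then show "k + 1 \<le> d"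
      using ptree_computes_fk_depth[OF kn] by fastforce
  qed
qed

end
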